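(* Let $k$ be an algebraically closed field of characteristic $0$, let $L/K$ be a finite Galois extension of fields finitely generated over $k$, and let $\pi:\operatorname{Spec}L\to\operatorname{Spec}K$ be the associated morphism. If $M$ is a simple $\mathcal D_L$-module (of finite dimension over $L$) with trivial inertia group $G_M=\{e\}$, then $\pi_+(M)$ is a simple $\mathcal D_K$-module.
   Context: $\mathcal D_L$, $\mathcal D_K$ are the rings of $k$-linear differential operators of $L$ and $K$; there is a canonical inclusion $\mathcal D_K\subset\mathcal D_L=L\otimes_K\mathcal D_K$, and $\pi_+(M)$ is $M$ regarded as a $\mathcal D_K$-module. For $g\in\operatorname{Aut}_K(L)$ the twisted module $M_g$ equals $M$ as a set, with action $P\cdot m=(g^{-1}Pg)m$ for $P\in\mathcal D_L$. The inertia group of $M$ over $K$ is $G_M=\{g\in\operatorname{Aut}_K(L)\mid M_g\cong M\}$. *)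

theory Defs
  imports "HOL-Computational_Algebra.Computational_Algebra"
begin

text \<open>
  Fields are types, and a field extension \<open>F \<subseteq> E\<close> is a field homomorphism \<open>\<iota> :: F \<Rightarrow> E\<close>.  In a tower
  \<open>k \<subseteq> K \<subseteq> L\<close> the letters are \<open>\<kappa> :: k \<Rightarrow> K\<close> and \<open>\<iota> :: K \<Rightarrow> L\<close>, so that \<open>L\<close> is an extension of
  \<open>k\<close> via \<open>\<iota> \<circ> \<kappa>\<close>.
\<close>

section \<open>Field extensions\<close>

definition field_embedding :: "('a::field \<Rightarrow> 'b::field) \<Rightarrow> bool" where
  "field_embedding \<iota> \<longleftrightarrow>
     \<iota> 1 = 1 \<and> (\<forall>x y. \<iota> (x + y) = \<iota> x + \<iota> y) \<and> (\<forall>x y. \<iota> (x * y) = \<iota> x * \<iota> y)"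

definition is_subfield :: "'b::field set \<Rightarrow> bool" where
  "is_subfield F \<longleftrightarrow> 0 \<in> F \<and> 1 \<in> F \<and>
     (\<forall>x\<in>F. \<forall>y\<in>F. x + y \<in> F \<and> x * y \<in> F) \<and> (\<forall>x\<in>F. - x \<in> F \<and> inverse x \<in> F)"

definition fin_gen_extension :: "('a::field \<Rightarrow> 'b::field) \<Rightarrow> bool" where
  "fin_gen_extension \<iota> \<longleftrightarrow> (\<exists>S. finite S \<and> is_subfield hull (range \<iota> \<union> S) = UNIV)"

definition finite_extension :: "('a::field \<Rightarrow> 'b::field) \<Rightarrow> bool" where
  "finite_extension \<iota> \<longleftrightarrow> (\<exists>B. finite_dimensional_vector_space (\<lambda>a x. \<iota> a * x) B)"

definition field_auts :: "('a::field \<Rightarrow> 'b::field) \<Rightarrow> ('b \<Rightarrow> 'b) set" where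
  "field_auts \<iota> = {g. field_embedding g \<and> bij g \<and> (\<forall>a. g (\<iota> a) = \<iota> a)}"

definition finite_galois_extension :: "('a::field \<Rightarrow> 'b::field) \<Rightarrow> bool" where
  "finite_galois_extension \<iota> \<longleftrightarrow>
     finite_extension \<iota> \<and> {x. \<forall>g\<in>field_auts \<iota>. g x = x} = range \<iota>"

section \<open>Differential operators\<close>

definition commutator :: "('b::field \<Rightarrow> 'b) \<Rightarrow> 'b \<Rightarrow> 'b \<Rightarrow> 'b" where
  "commutator P a = (\<lambda>x. P (a * x) - a * P x)"

text \<open>
  Grothendieck's definition: a linear endomorphism has order \<open>\<le> 0\<close> if it commutes with all
  multiplications, and order \<open>\<le> n + 1\<close> if its commutators with all multiplications have order \<open>\<le> n\<close>.
\<close>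

primrec diff_ops_upto :: "('k::field \<Rightarrow> 'b::field) \<Rightarrow> nat \<Rightarrow> ('b \<Rightarrow> 'b) set" where
  "diff_ops_upto \<kappa> 0 =
     {P. Vector_Spaces.linear (\<lambda>c x. \<kappa> c * x) (\<lambda>c x. \<kappa> c * x) P \<and> (\<forall>a. commutator P a = (\<lambda>_. 0))}"
| "diff_ops_upto \<kappa> (Suc n) =
     {P. Vector_Spaces.linear (\<lambda>c x. \<kappa> c * x) (\<lambda>c x. \<kappa> c * x) P \<and>
         (\<forall>a. commutator P a \<in> diff_ops_upto \<kappa> n)}"

definition diff_ops :: "('k::field \<Rightarrow> 'b::field) \<Rightarrow> ('b \<Rightarrow> 'b) set" where
  "diff_ops \<kappa> = (\<Union>n. diff_ops_upto \<kappa> n)"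

text \<open>
  The canonical inclusion of the differential operators of \<open>K\<close> into those of \<open>L\<close>, for \<open>L/K\<close> finite
  separable: every \<open>Q\<close> extends uniquely to a differential operator on \<open>L\<close>.
\<close>

definition diff_op_extension ::
    "('k::field \<Rightarrow> 'a::field) \<Rightarrow> ('a \<Rightarrow> 'b::field) \<Rightarrow> ('a \<Rightarrow> 'a) \<Rightarrow> ('b \<Rightarrow> 'b)" where
  "diff_op_extension \<kappa> \<iota> Q = (THE P. P \<in> diff_ops (\<iota> \<circ> \<kappa>) \<and> (\<forall>a. P (\<iota> a) = \<iota> (Q a)))"

section \<open>Modules over a ring of operators\<close>

text \<open>
  \<open>D\<close> is a ring of additive endomaps under pointwise addition and composition.  A left \<open>D\<close>-module is
  an abelian group type with an action; the action of functions outside \<open>D\<close> is irrelevant.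
\<close>

definition op_module :: "('b::ab_group_add \<Rightarrow> 'b) set \<Rightarrow> (('b \<Rightarrow> 'b) \<Rightarrow> 'm::ab_group_add \<Rightarrow> 'm) \<Rightarrow> bool" where
  "op_module D act \<longleftrightarrow>
     (\<forall>m. act id m = m) \<and>
     (\<forall>P\<in>D. \<forall>m n. act P (m + n) = act P m + act P n) \<and>
     (\<forall>P\<in>D. \<forall>Q\<in>D. \<forall>m. act (\<lambda>x. P x + Q x) m = act P m + act Q m) \<and>
     (\<forall>P\<in>D. \<forall>Q\<in>D. \<forall>m. act (P \<circ> Q) m = act P (act Q m))"

definition op_submodule ::
    "('b \<Rightarrow> 'b) set \<Rightarrow> (('b \<Rightarrow> 'b) \<Rightarrow> 'm::ab_group_add \<Rightarrow> 'm) \<Rightarrow> 'm set \<Rightarrow> bool" where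
  "op_submodule D act N \<longleftrightarrow>
     0 \<in> N \<and> (\<forall>m\<in>N. \<forall>n\<in>N. m - n \<in> N) \<and> (\<forall>P\<in>D. \<forall>m\<in>N. act P m \<in> N)"

definition simple_op_module ::
    "('b::ab_group_add \<Rightarrow> 'b) set \<Rightarrow> (('b \<Rightarrow> 'b) \<Rightarrow> 'm::ab_group_add \<Rightarrow> 'm) \<Rightarrow> bool" where
  "simple_op_module D act \<longleftrightarrow>
     op_module D act \<and> (UNIV :: 'm set) \<noteq> {0} \<and> (\<forall>N. op_submodule D act N \<longrightarrow> N = {0} \<or> N = UNIV)"

definition op_module_iso ::
    "('b \<Rightarrow> 'b) set \<Rightarrow> (('b \<Rightarrow> 'b) \<Rightarrow> 'm::ab_group_add \<Rightarrow> 'm) \<Rightarrow>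
     (('b \<Rightarrow> 'b) \<Rightarrow> 'n::ab_group_add \<Rightarrow> 'n) \<Rightarrow> bool" where
  "op_module_iso D act act' \<longleftrightarrow>
     (\<exists>\<phi>. bij \<phi> \<and> (\<forall>m n. \<phi> (m + n) = \<phi> m + \<phi> n) \<and> (\<forall>P\<in>D. \<forall>m. \<phi> (act P m) = act' P (\<phi> m)))"

definition finite_dim_module :: "(('b::field \<Rightarrow> 'b) \<Rightarrow> 'm::ab_group_add \<Rightarrow> 'm) \<Rightarrow> bool" where
  "finite_dim_module act \<longleftrightarrow> (\<exists>B. finite_dimensional_vector_space (\<lambda>l m. act (\<lambda>x. l * x) m) B)"

definition twisted_action ::
    "('b \<Rightarrow> 'b) \<Rightarrow> (('b \<Rightarrow> 'b) \<Rightarrow> 'm \<Rightarrow> 'm) \<Rightarrow> ('b \<Rightarrow> 'b) \<Rightarrow> 'm \<Rightarrow> 'm" where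
  "twisted_action g act P m = act (inv g \<circ> P \<circ> g) m"

definition inertia_group ::
    "('k::field \<Rightarrow> 'a::field) \<Rightarrow> ('a \<Rightarrow> 'b::field) \<Rightarrow>
     (('b \<Rightarrow> 'b) \<Rightarrow> 'm::ab_group_add \<Rightarrow> 'm) \<Rightarrow> ('b \<Rightarrow> 'b) set" where
  "inertia_group \<kappa> \<iota> act =
     {g \<in> field_auts \<iota>. op_module_iso (diff_ops (\<iota> \<circ> \<kappa>)) (twisted_action g act) act}"

text \<open>The action on \<open>\<pi>\<^sub>+(M)\<close>: restriction of scalars along the canonical inclusion.\<close>

definition direct_image ::
    "('k::field \<Rightarrow> 'a::field) \<Rightarrow> ('a \<Rightarrow> 'b::field) \<Rightarrow>
     (('b \<Rightarrow> 'b) \<Rightarrow> 'm \<Rightarrow> 'm) \<Rightarrow> ('a \<Rightarrow> 'a) \<Rightarrow> 'm \<Rightarrow> 'm" where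
  "direct_image \<kappa> \<iota> act Q m = act (diff_op_extension \<kappa> \<iota> Q) m"

end

theory Submission
  imports Defs
begin

text \<open>
  Let \<open>G = Aut\<^sub>K(L)\<close> and let \<open>\<Sum>j. b j \<otimes> c j \<in> L \<otimes>\<^sub>K L\<close> be the separability idempotent, that is,
  \<open>\<Sum>j. b j * g (c j) = \<delta> g 1\<close> for \<open>g \<in> G\<close>.  The averaging \<open>T \<mapsto> (\<Sum>j. b j \<circ> T \<circ> c j)\<close>, iterated, turns a map
  with vanishing iterated commutators with \<open>K\<close> into a differential operator on \<open>L\<close>.  Applied to
  \<open>Q \<circ> tr\<close> it extends a differential operator \<open>Q\<close> from \<open>K\<close> to \<open>L\<close> up to lower order terms; together
  with uniqueness of the extension this gives \<open>D\<^sub>L = (\<Sum>j. b j * D\<^sub>K)\<close>.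

  If \<open>N\<close> is a nonzero \<open>D\<^sub>K\<close>-submodule of \<open>M\<close>, then \<open>L \<otimes>\<^sub>K N\<close> is a \<open>D\<^sub>L\<close>-submodule of
  \<open>L \<otimes>\<^sub>K M \<cong> (\<Oplus>g\<in>G. M\<^sub>g)\<close>, a sum of pairwise non-isomorphic simple modules.  Hence it contains a whole
  summand, and the sum over \<open>G\<close> of the coordinates (the trace of \<open>L/K\<close>) maps \<open>L \<otimes>\<^sub>K N\<close> into \<open>N\<close> and a
  summand onto \<open>M\<close>.
\<close>

section \<open>Field embeddings\<close>

lemma field_embeddingD:
  assumes "field_embedding f"
  shows "f 1 = 1" "f (x + y) = f x + f y" "f (x * y) = f x * f y" "f 0 = 0"
    "f (- x) = - f x" "f (x - y) = f x - f y" "f (x ^ n) = f x ^ n"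
    "f (sum h A) = (\<Sum>i\<in>A. f (h i))" "inj f"
proof -
  show 1: "f 1 = 1" and add: "f (x + y) = f x + f y" and mult: "f (x * y) = f x * f y" for x y
    using assms by (auto simp: field_embedding_def)
  show 0: "f 0 = 0" by (metis add add_0 add_cancel_left_left)
  show minus: "f (- x) = - f x" for x
    using add[of "- x" x] 0 by (simp add: eq_neg_iff_add_eq_0)
  show diff: "f (x - y) = f x - f y" for x y
    using add[of x "- y"] minus by simp
  show "f (x ^ n) = f x ^ n"
    by (induction n) (auto simp: 1 mult)
  show "f (sum h A) = (\<Sum>i\<in>A. f (h i))"
    by (induction A rule: infinite_finite_induct) (auto simp: 0 add)
  show "inj f"
  proof (rule injI, rule ccontr)
    fix x y assume "f x = f y" "x \<noteq> y"
    then have "f ((x - y) * inverse (x - y)) = 0"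
      by (simp only: mult diff) simp
    moreover have "(x - y) * inverse (x - y) = 1"
      using \<open>x \<noteq> y\<close> by simp
    ultimately show False
      using 1 by simp
  qed
qed

lemma field_embedding_comp:
  "field_embedding f \<Longrightarrow> field_embedding g \<Longrightarrow> field_embedding (f \<circ> g)"
  by (auto simp: field_embedding_def)

lemma field_embedding_linear_iff:
  assumes "field_embedding \<epsilon>"
  shows "Vector_Spaces.linear (\<lambda>c x. \<epsilon> c * x) (\<lambda>c x. \<epsilon> c * x) P \<longleftrightarrow>
    (\<forall>x y. P (x + y) = P x + P y) \<and> (\<forall>c x. P (\<epsilon> c * x) = \<epsilon> c * P x)"
proof -
  have v: "vector_space (\<lambda>c x. \<epsilon> c * x)"
    by unfold_locales (auto simp: field_embeddingD[OF assms] algebra_simps)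
  then have "module (\<lambda>c x. \<epsilon> c * x)"
    by (simp add: module_iff_vector_space)
  with v show ?thesis
    unfolding linear_iff_module_hom module_hom_iff by blast
qed

section \<open>Maps with vanishing iterated commutators\<close>

text \<open>Grothendieck's order condition for maps between two spaces acted on by the same scalars.
  Keeping the actions \<open>s\<close> and \<open>t\<close> separate lets one notion serve operators
  on \<open>K\<close> or \<open>L\<close>, maps from \<open>K\<close> to \<open>L\<close>, and
  commutators with \<open>K\<close> only.\<close>

primrec nil_comm ::
    "('r \<Rightarrow> 'x \<Rightarrow> 'x) \<Rightarrow> ('r \<Rightarrow> 'y::ab_group_add \<Rightarrow> 'y) \<Rightarrow> nat \<Rightarrow> ('x \<Rightarrow> 'y) \<Rightarrow> bool" where
  "nil_comm s t 0 T \<longleftrightarrow> (\<forall>r x. T (s r x) = t r (T x))"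
| "nil_comm s t (Suc n) T \<longleftrightarrow> (\<forall>r. nil_comm s t n (\<lambda>x. T (s r x) - t r (T x)))"

lemma nil_comm_zero:
  assumes "\<And>r. additive (t r)"
  shows "nil_comm s t n (\<lambda>_. 0)"
  by (induction n) (auto simp: additive.zero[OF assms])

lemma nil_comm_Suc:
  assumes "\<And>r. additive (t r)"
  shows "nil_comm s t n T \<Longrightarrow> nil_comm s t (Suc n) T"
proof (induction n arbitrary: T)
  case 0
  then show ?case by (simp add: additive.zero[OF assms])
next
  case (Suc n)
  then have "nil_comm s t n (\<lambda>x. T (s r x) - t r (T x))" for r
    by simp
  then have "nil_comm s t (Suc n) (\<lambda>x. T (s r x) - t r (T x))" for r
    by (rule Suc.IH)
  then show ?case by simp
qed

lemma nil_comm_mono: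
  assumes "\<And>r. additive (t r)" "n \<le> m" "nil_comm s t n T"
  shows "nil_comm s t m T"
  using assms(2,3)
proof (induction m rule: dec_induct)
  case (step m)
  then show ?case
    by (intro nil_comm_Suc assms(1)) blast
qed

lemma nil_comm_add:
  assumes "\<And>r. additive (t r)"
  shows "nil_comm s t n T \<Longrightarrow> nil_comm s t n U \<Longrightarrow> nil_comm s t n (\<lambda>x. T x + U x)"
proof (induction n arbitrary: T U)
  case 0
  then show ?case by (simp add: additive.add[OF assms])
next
  case (Suc n)
  have "(\<lambda>x. T (s r x) + U (s r x) - t r (T x + U x))
      = (\<lambda>x. (T (s r x) - t r (T x)) + (U (s r x) - t r (U x)))" for r
    by (simp add: additive.add[OF assms] algebra_simps)
  then show ?case
    using Suc by simp
qed

lemma nil_comm_sum: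
  assumes "\<And>r. additive (t r)" "\<And>i. i \<in> I \<Longrightarrow> nil_comm s t n (T i)"
  shows "nil_comm s t n (\<lambda>x. \<Sum>i\<in>I. T i x)"
  using assms(2)
proof (induction I rule: infinite_finite_induct)
  case (insert i I)
  then have "nil_comm s t n (\<lambda>x. T i x + (\<Sum>i\<in>I. T i x))"
    by (intro nil_comm_add assms(1)) auto
  with insert show ?case by simp
qed (simp_all add: nil_comm_zero assms(1))

lemma nil_comm_comp_left:
  assumes "additive V" "\<And>r y. V (t r y) = t' r (V y)"
  shows "nil_comm s t n T \<Longrightarrow> nil_comm s t' n (\<lambda>x. V (T x))"
proof (induction n arbitrary: T)
  case 0
  then show ?case by (simp add: assms)
next
  case (Suc n)
  then have "nil_comm s t' n (\<lambda>x. V (T (s r x) - t r (T x)))" for r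
    by simp
  then show ?case
    by (simp add: assms additive.diff[OF assms(1)])
qed

lemma nil_comm_comp_right:
  assumes "\<And>r x. U (s' r x) = s r (U x)"
  shows "nil_comm s t n T \<Longrightarrow> nil_comm s' t n (\<lambda>x. T (U x))"
proof (induction n arbitrary: T)
  case 0
  then show ?case by (simp add: assms)
next
  case (Suc n)
  then have "nil_comm s t n (\<lambda>x. T (s r x) - t r (T x))" for r
    by simp
  from Suc.IH[OF this] show ?case
    by (simp add: assms)
qed

text \<open>Only commutators with scalars in the range of \<open>f\<close> are tested. Used with
  \<open>\<iota>\<close> to pass from scalars in \<open>L\<close> to scalars in \<open>K\<close>,
  and with \<open>inv g\<close> for conjugation.\<close>

lemma nil_comm_restrict:
  "nil_comm s t n T \<Longrightarrow> nil_comm (\<lambda>r. s (f r)) (\<lambda>r. t (f r)) n T"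
  by (induction n arbitrary: T) auto

text \<open>The product rule \<open>[PQ, r] = P[Q, r] + [P, r]Q\<close> lowers one of the two orders
  in each summand, hence the induction on \<open>n + m\<close>. A factor of order zero commutes with
  the actions.\<close>

lemma nil_comm_comp:
  fixes s :: "'r \<Rightarrow> 'x \<Rightarrow> 'x" and t :: "'r \<Rightarrow> 'y::ab_group_add \<Rightarrow> 'y"
    and u :: "'r \<Rightarrow> 'z::ab_group_add \<Rightarrow> 'z"
  assumes u: "\<And>r. additive (u r)" and t: "\<And>r. additive (t r)"
  shows "additive P \<Longrightarrow> nil_comm t u n P \<Longrightarrow> nil_comm s t m Q \<Longrightarrow>
    nil_comm s u (n + m) (\<lambda>x. P (Q x))"
proof (induction "n + m" arbitrary: n m P Q)
  case 0
  then show ?case by simp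
next
  case (Suc k)
  consider "n = 0" | "m = 0" | n' m' where "n = Suc n'" "m = Suc m'"
    by (cases n; cases m) auto
  then show ?case
  proof cases
    case 1
    with Suc.prems show ?thesis
      using nil_comm_comp_left[of P t u s m Q] by simp
  next
    case 2
    with Suc.prems show ?thesis
      using nil_comm_comp_right[of Q s t u n P] by simp
  next
    case 3
    have add: "additive (\<lambda>y. P (t r y) - u r (P y))" for r
      using Suc.prems(1) u[of r] t[of r] by (simp add: additive_def)
    have k: "k = n + m'" "k = n' + m" "n + m = Suc k"
      using Suc.hyps(2) 3 by auto
    have "nil_comm s t m' (\<lambda>x. Q (s r x) - t r (Q x))" "nil_comm t u n' (\<lambda>y. P (t r y) - u r (P y))" for r
      using Suc.prems(2,3) 3 by auto
    then have "nil_comm s u k (\<lambda>x. P (Q (s r x) - t r (Q x)))"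
        "nil_comm s u k (\<lambda>x. P (t r (Q x)) - u r (P (Q x)))" for r
      using Suc.hyps(1)[OF k(1) Suc.prems(1,2)] Suc.hyps(1)[OF k(2) add _ Suc.prems(3)] k(1,2)
      by simp_all
    then have "nil_comm s u k (\<lambda>x. P (Q (s r x)) - u r (P (Q x)))" for r
      using nil_comm_add[of u s k "\<lambda>x. P (Q (s r x) - t r (Q x))" "\<lambda>x. P (t r (Q x)) - u r (P (Q x))"] u
      by (simp add: additive.diff[OF Suc.prems(1)])
    then show ?thesis
      by (simp add: k(3))
  qed
qed

section \<open>Differential operators\<close>

lemma additive_mult_left: "additive ((*) (c :: 'c::field))"
  by (simp add: additive_def distrib_left)

text \<open>Commutators of a linear map are again linear, so linearity, imposed at every level of
  the definition, has to be asked only once.\<close>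

lemma diff_ops_upto_iff:
  assumes "field_embedding \<epsilon>"
  shows "P \<in> diff_ops_upto \<epsilon> n \<longleftrightarrow>
    additive P \<and> (\<forall>c x. P (\<epsilon> c * x) = \<epsilon> c * P x) \<and> nil_comm (*) (*) n P"
proof (induction n arbitrary: P)
  case 0
  show ?case
    by (auto simp: field_embedding_linear_iff[OF assms] commutator_def additive_def fun_eq_iff)
next
  case (Suc n)
  have "additive (commutator P a)" if "additive P" for a
    using that by (simp add: commutator_def additive_def algebra_simps)
  moreover have "commutator P a (\<epsilon> c * x) = \<epsilon> c * commutator P a x"
    if "\<forall>c x. P (\<epsilon> c * x) = \<epsilon> c * P x" for a c x
    using that[rule_format, of c "a * x"] that by (simp add: commutator_def algebra_simps)
  ultimately show ?case
    by (simp add: field_embedding_linear_iff[OF assms] Suc flip: additive_def[of P])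
      (auto simp: commutator_def)
qed

lemma diff_ops_iff:
  assumes "field_embedding \<epsilon>"
  shows "P \<in> diff_ops \<epsilon> \<longleftrightarrow>
    additive P \<and> (\<forall>c x. P (\<epsilon> c * x) = \<epsilon> c * P x) \<and> (\<exists>n. nil_comm (*) (*) n P)"
  by (auto simp: diff_ops_def diff_ops_upto_iff[OF assms])

context
  fixes \<epsilon> :: "'k::field \<Rightarrow> 'c::field"
  assumes \<epsilon>: "field_embedding \<epsilon>"
begin

lemma diff_ops_mult: "(*) a \<in> diff_ops \<epsilon>"
  unfolding diff_ops_iff[OF \<epsilon>]
  by (auto simp: additive_mult_left algebra_simps intro!: exI[of _ 0])

lemma diff_ops_add:
  assumes "P \<in> diff_ops \<epsilon>" "Q \<in> diff_ops \<epsilon>"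
  shows "(\<lambda>x. P x + Q x) \<in> diff_ops \<epsilon>"
proof -
  from assms obtain n m where "nil_comm (*) (*) n P" "nil_comm (*) (*) m Q"
    unfolding diff_ops_iff[OF \<epsilon>] by blast
  then have "nil_comm (*) (*) (max n m) (\<lambda>x. P x + Q x)"
    by (intro nil_comm_add nil_comm_mono[of "(*)" n "max n m"] nil_comm_mono[of "(*)" m "max n m"]
        additive_mult_left) auto
  with assms show ?thesis
    unfolding diff_ops_iff[OF \<epsilon>] by (auto simp: additive_def algebra_simps)
qed

lemma diff_ops_comp:
  assumes "P \<in> diff_ops \<epsilon>" "Q \<in> diff_ops \<epsilon>"
  shows "P \<circ> Q \<in> diff_ops \<epsilon>"
proof -
  from assms obtain n m where *: "nil_comm (*) (*) n P" "nil_comm (*) (*) m Q"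
    unfolding diff_ops_iff[OF \<epsilon>] by blast
  have "nil_comm (*) (*) (n + m) (\<lambda>x. P (Q x))"
    by (rule nil_comm_comp[OF additive_mult_left additive_mult_left _ *])
      (use assms diff_ops_iff[OF \<epsilon>] in blast)
  with assms show ?thesis
    unfolding diff_ops_iff[OF \<epsilon>] by (auto simp: additive_def o_def)
qed

lemma diff_ops_id: "id \<in> diff_ops \<epsilon>"
  proof -
  have "id = (*) (1 :: 'c)"
    by (simp add: fun_eq_iff)
  then show ?thesis
    using diff_ops_mult by metis
qed

lemma diff_ops_zero: "(\<lambda>_. 0) \<in> diff_ops \<epsilon>"
proof -
  have "(\<lambda>_. 0) = (*) (0 :: 'c)"
    by (simp add: fun_eq_iff)
  then show ?thesis
    using diff_ops_mult by metis
qed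

lemma diff_ops_sum:
  "(\<And>i. i \<in> I \<Longrightarrow> P i \<in> diff_ops \<epsilon>) \<Longrightarrow> (\<lambda>x. \<Sum>i\<in>I. P i x) \<in> diff_ops \<epsilon>"
  by (induction I rule: infinite_finite_induct) (simp_all add: diff_ops_zero diff_ops_add)

end

section \<open>The Galois group and its dual system\<close>

locale galois_tower =
  fixes \<kappa> :: "'k::field \<Rightarrow> 'a::field" and \<iota> :: "'a \<Rightarrow> 'b::field"
  assumes \<kappa>: "field_embedding \<kappa>" and \<iota>: "field_embedding \<iota>"
    and galois: "finite_galois_extension \<iota>"
begin

abbreviation "G \<equiv> field_auts \<iota>"

lemmas \<iota>_simps = field_embeddingD[OF \<iota>]

lemma \<iota>_eq_0: "\<iota> a = 0 \<longleftrightarrow> a = 0"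
  using \<iota>_simps(4) injD[OF \<iota>_simps(9)] by metis

lemma \<iota>\<kappa>: "field_embedding (\<iota> \<circ> \<kappa>)"
  by (rule field_embedding_comp[OF \<iota> \<kappa>])

lemma G_embedding: "g \<in> G \<Longrightarrow> field_embedding g"
  and G_bij: "g \<in> G \<Longrightarrow> bij g"
  and G_fix: "g \<in> G \<Longrightarrow> g (\<iota> a) = \<iota> a"
  by (simp_all add: field_auts_def)

lemmas G_simps = field_embeddingD[OF G_embedding]

lemma id_in_G: "id \<in> G"
  by (simp add: field_auts_def field_embedding_def)

lemma comp_in_G: "g \<in> G \<Longrightarrow> h \<in> G \<Longrightarrow> g \<circ> h \<in> G"
  by (auto simp: field_auts_def intro: field_embedding_comp bij_comp)

lemma G_inv_f: "g \<in> G \<Longrightarrow> inv g (g x) = x"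
  and G_f_inv: "g \<in> G \<Longrightarrow> g (inv g x) = x"
  by (simp_all add: G_bij bij_is_inj bij_is_surj surj_f_inv_f)

lemma inv_in_G:
  assumes "g \<in> G"
  shows "inv g \<in> G"
proof -
  have eqI: "inv g x = y" if "x = g y" for x y
    using G_inv_f[OF assms] that by simp
  have "field_embedding (inv g)"
    unfolding field_embedding_def
    by (intro conjI allI eqI) (simp_all add: G_simps(1-3)[OF assms] G_f_inv[OF assms])
  moreover have "inv g (\<iota> a) = \<iota> a" for a
    by (rule eqI) (simp add: G_fix[OF assms])
  ultimately show ?thesis
    using bij_imp_bij_inv[OF G_bij[OF assms]] by (simp add: field_auts_def)
qed

section \<open>Finiteness of the Galois group\<close>

text \<open>Two equal powers of \<open>x\<close>, or else a \<open>K\<close>-linear relation among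
  distinct powers, give a polynomial whose coefficients are fixed by \<open>G\<close>. Dependence
  concerns the set of powers, so repetitions are treated first.\<close>

lemma algebraic: "\<exists>p. p \<noteq> 0 \<and> (\<forall>g\<in>G. poly p (g x) = 0)"
proof (cases "inj (\<lambda>i::nat. x ^ i)")
  case False
  then obtain i j :: nat where ij: "i \<noteq> j" "x ^ i = x ^ j"
    by (auto simp: inj_def)
  show ?thesis
  proof (intro exI[of _ "monom 1 i - monom 1 j"] conjI ballI)
    have "coeff (monom 1 i - monom 1 j :: 'b poly) i = 1"
      using ij(1) by simp
    then show "monom 1 i - monom 1 j \<noteq> (0 :: 'b poly)"
      by force
  next
    fix g assume "g \<in> G"
    then have "g x ^ i = g x ^ j"
      using ij(2) G_simps(7)[of g x] by metis
    then show "poly (monom 1 i - monom 1 j) (g x) = 0"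
      by (simp add: poly_monom)
  qed
next
  case True
  obtain B where "finite_dimensional_vector_space (\<lambda>a x. \<iota> a * x) B"
    using galois by (auto simp: finite_galois_extension_def finite_extension_def)
  then interpret V: finite_dimensional_vector_space "\<lambda>a x. \<iota> a * x" B .
  have "infinite (range (\<lambda>i::nat. x ^ i))"
    by (rule range_inj_infinite[OF True])
  then have "V.dependent (range (\<lambda>i::nat. x ^ i))"
    using V.finiteI_independent by blast
  then obtain T u where T: "finite T" "T \<subseteq> range (\<lambda>i::nat. x ^ i)" and
    u: "(\<Sum>v\<in>T. \<iota> (u v) * v) = 0" "\<exists>v\<in>T. u v \<noteq> 0"
    unfolding V.dependent_explicit by blast
  define I where "I = {i. x ^ i \<in> T}"
  have T_eq: "T = (\<lambda>i. x ^ i) ` I"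
    using T(2) by (auto simp: I_def)
  have inj: "inj_on (\<lambda>i. x ^ i) I"
    by (rule inj_on_subset[OF True]) simp
  have "finite I"
    using T(1) finite_imageD[OF _ inj] by (simp add: T_eq)
  define p where "p = (\<Sum>i\<in>I. monom (\<iota> (u (x ^ i))) i)"
  have "coeff p i = (if i \<in> I then \<iota> (u (x ^ i)) else 0)" for i
    using \<open>finite I\<close> by (simp add: p_def coeff_sum)
  moreover obtain i where "i \<in> I" "\<iota> (u (x ^ i)) \<noteq> 0"
    using u(2) by (auto simp: T_eq \<iota>_eq_0)
  ultimately have "p \<noteq> 0"
    by (metis coeff_0)
  moreover have "poly p (g x) = 0" if "g \<in> G" for g
  proof -
    have "poly p (g x) = (\<Sum>i\<in>I. g (\<iota> (u (x ^ i)) * x ^ i))"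
      by (simp add: p_def poly_sum poly_monom G_simps[OF that] G_fix[OF that])
    also have "\<dots> = g (\<Sum>v\<in>T. \<iota> (u v) * v)"
      by (simp add: T_eq sum.reindex[OF inj] G_simps(8)[OF that])
    finally show ?thesis
      by (simp add: u(1) G_simps(4)[OF that])
  qed
  ultimately show ?thesis
    by (intro exI[of _ p]) simp
qed

text \<open>An automorphism is determined by its values on a finite basis, and each value is a root
  of a fixed nonzero polynomial.\<close>

lemma finite_G: "finite G"
proof -
  obtain B where "finite_dimensional_vector_space (\<lambda>a x. \<iota> a * x) B"
    using galois by (auto simp: finite_galois_extension_def finite_extension_def)
  then interpret V: finite_dimensional_vector_space "\<lambda>a x. \<iota> a * x" B .
  have fin: "finite ((\<lambda>g. g x) ` G)" for x
  proof -
    obtain p where "p \<noteq> 0" "\<forall>g\<in>G. poly p (g x) = 0"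
      using algebraic by blast
    then show ?thesis
      by (intro finite_subset[OF _ poly_roots_finite[of p]]) auto
  qed
  have "(\<lambda>g. restrict g B) ` G \<subseteq> (\<Pi>\<^sub>E x\<in>B. (\<lambda>g. g x) ` G)"
    by auto
  then have "finite ((\<lambda>g. restrict g B) ` G)"
    by (rule finite_subset) (intro finite_PiE V.finite_Basis fin)
  moreover have "inj_on (\<lambda>g. restrict g B) G"
  proof (rule inj_onI, rule ext)
    fix g h x assume g: "g \<in> G" and h: "h \<in> G" and eq: "restrict g B = restrict h B"
    have "x \<in> V.span B"
      by (simp add: V.span_Basis)
    then show "g x = h x"
    proof (induction rule: V.span_induct_alt)
      case base
      show ?case by (simp add: G_simps(4)[OF g] G_simps(4)[OF h])
    next
      case (step c b y)
      then show ?case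
        using fun_cong[OF eq, of b] by (simp add: G_simps[OF g] G_simps[OF h] G_fix[OF g] G_fix[OF h] step.hyps)
    qed
  qed
  ultimately show ?thesis
    by (rule finite_imageD)
qed

section \<open>The separability idempotent\<close>

text \<open>A list of pairs stands for an element of \<open>L \<otimes> L\<close>, evaluated at
  \<open>g\<close> by \<open>b \<otimes> c \<mapsto> b * g c\<close>. One factor for each
  \<open>h \<noteq> id\<close> makes the value at \<open>h\<close> vanish while the value at
  \<open>id\<close> stays nonzero.\<close>

lemma separating_list:
  assumes "finite S" "S \<subseteq> G"
  shows "\<exists>xs. (\<Sum>(b, c)\<leftarrow>xs. b * c) \<noteq> 0 \<and> (\<forall>g\<in>S - {id}. (\<Sum>(b, c)\<leftarrow>xs. b * g c) = 0)"
  using assms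
proof (induction S)
  case empty
  show ?case
    by (rule exI[of _ "[(1, 1)]"]) simp
next
  case (insert h S)
  then obtain xs where xs: "(\<Sum>(b, c)\<leftarrow>xs. b * c) \<noteq> 0"
    "\<forall>g\<in>S - {id}. (\<Sum>(b, c)\<leftarrow>xs. b * g c) = 0"
    by blast
  show ?case
  proof (cases "h = id")
    case True
    then have "insert h S - {id} = S - {id}"
      by blast
    with xs show ?thesis by metis
  next
    case False
    then obtain u where u: "h u \<noteq> u"
      by (auto simp: fun_eq_iff)
    \<comment> \<open>The product of \<open>xs\<close> with
      \<open>h u \<otimes> 1 - 1 \<otimes> u\<close>, whose value at \<open>g\<close> is
      \<open>h u - g u\<close>.\<close>
    define ys where "ys = map (\<lambda>(b, c). (h u * b, c)) xs @ map (\<lambda>(b, c). (- b, u * c)) xs"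
    have *: "(\<Sum>(b, c)\<leftarrow>ys. b * g c) = (h u - g u) * (\<Sum>(b, c)\<leftarrow>xs. b * g c)" if "g \<in> G" for g
    proof -
      have "(\<Sum>(b, c)\<leftarrow>map (\<lambda>(b, c). (h u * b, c)) xs. b * g c) = h u * (\<Sum>(b, c)\<leftarrow>xs. b * g c)"
        by (induction xs) (auto simp: distrib_left)
      moreover have "(\<Sum>(b, c)\<leftarrow>map (\<lambda>(b, c). (- b, u * c)) xs. b * g c) = - g u * (\<Sum>(b, c)\<leftarrow>xs. b * g c)"
        by (induction xs) (auto simp: distrib_left G_simps(3)[OF that])
      ultimately show ?thesis
        by (simp only: ys_def map_append sum_list_append) (simp add: left_diff_distrib)
    qed
    show ?thesis
    proof (intro exI[of _ ys] conjI ballI)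
      show "(\<Sum>(b, c)\<leftarrow>ys. b * c) \<noteq> 0"
        using *[OF id_in_G] xs(1) u by (simp only: id_apply) simp
      show "(\<Sum>(b, c)\<leftarrow>ys. b * g c) = 0" if "g \<in> insert h S - {id}" for g
      proof (cases "g = h")
        case True
        then show ?thesis
          using *[of h] insert.prems by simp
      next
        case False
        with that insert.prems have "g \<in> S - {id}" "g \<in> G"
          by auto
        then show ?thesis
          using *[of g] xs(2) by simp
      qed
    qed
  qed
qed

text \<open>Take a separating list for all of \<open>G\<close> and divide its first components by
  the value at \<open>id\<close>.\<close>

lemma dual_system_exists:
  "\<exists>(J::nat) b c. \<forall>g\<in>G. (\<Sum>j<J. b j * g (c j)) = (if g = id then 1 else 0)"
proof -
  obtain xs where xs: "(\<Sum>(b, c)\<leftarrow>xs. b * c) \<noteq> 0" "\<forall>g\<in>G - {id}. (\<Sum>(b, c)\<leftarrow>xs. b * g c) = 0"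
    using separating_list[OF finite_G subset_refl] by blast
  define s where "s = (\<Sum>(b, c)\<leftarrow>xs. b * c)"
  have nth: "(\<Sum>j<length xs. fst (xs ! j) / s * g (snd (xs ! j))) = (\<Sum>(b, c)\<leftarrow>xs. b * g c) / s" for g :: "'b \<Rightarrow> 'b"
    by (simp add: sum_list_sum_nth atLeast0LessThan sum_divide_distrib case_prod_beta)
  have "(\<Sum>j<length xs. fst (xs ! j) / s * g (snd (xs ! j))) = (if g = id then 1 else 0)" if "g \<in> G" for g
  proof (cases "g = id")
    case True
    with xs(1) show ?thesis unfolding nth by (simp add: s_def)
  next
    case False
    with xs(2) that have "(\<Sum>(b, c)\<leftarrow>xs. b * g c) = 0"
      by blast
    with False show ?thesis unfolding nth by simp
  qed
  then have "\<forall>g\<in>G. (\<Sum>j<length xs. fst (xs ! j) / s * g (snd (xs ! j))) = (if g = id then 1 else 0)" ..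
  then show ?thesis
    by (rule exI[of _ "length xs", OF exI[of _ "\<lambda>j. fst (xs ! j) / s", OF exI[of _ "\<lambda>j. snd (xs ! j)"]]])
qed

section \<open>The trace of \<open>L/K\<close> and trace expansions\<close>

definition Tr :: "'b \<Rightarrow> 'b" where
  "Tr x = (\<Sum>g\<in>G. g x)"

definition tr :: "'b \<Rightarrow> 'a" where
  "tr x = inv \<iota> (Tr x)"

text \<open>Composition with \<open>g\<close> permutes \<open>G\<close>, so the trace is fixed by
  \<open>G\<close> and lies in the image of \<open>K\<close> by the Galois property. Hence
  \<open>inv \<iota>\<close> in \<open>tr\<close> is applied only inside the range of
  \<open>\<iota>\<close>.\<close>

lemma \<iota>_tr: "\<iota> (tr x) = Tr x"
proof -
  have "g (Tr x) = Tr x" if "g \<in> G" for g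
  proof -
    have "g (Tr x) = (\<Sum>h\<in>G. (g \<circ> h) x)"
      by (simp add: Tr_def G_simps(8)[OF that])
    also have "\<dots> = (\<Sum>h\<in>G. h x)"
    proof (rule sum.reindex_bij_witness[of _ "\<lambda>h. inv g \<circ> h" "\<lambda>h. g \<circ> h"])
      fix h
      show "inv g \<circ> (g \<circ> h) = h" "g \<circ> (inv g \<circ> h) = h"
        using that by (auto simp: fun_eq_iff G_inv_f G_f_inv)
    qed (use that in \<open>auto intro: comp_in_G inv_in_G\<close>)
    finally show ?thesis
      by (simp add: Tr_def)
  qed
  then have "Tr x \<in> range \<iota>"
    using galois unfolding finite_galois_extension_def by blast
  then show ?thesis
    by (simp add: tr_def f_inv_into_f)
qed

lemma Tr_add: "Tr (x + y) = Tr x + Tr y"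
  by (simp add: Tr_def G_simps(2) sum.distrib)

lemma Tr_\<iota>_mult: "Tr (\<iota> a * x) = \<iota> a * Tr x"
  by (simp add: Tr_def G_simps(3) G_fix sum_distrib_left)

lemma tr_add: "tr (x + y) = tr x + tr y"
  by (rule injD[OF \<iota>_simps(9)]) (simp add: \<iota>_tr \<iota>_simps(2) Tr_add)

lemma tr_\<iota>_mult: "tr (\<iota> a * x) = a * tr x"
  by (rule injD[OF \<iota>_simps(9)]) (simp add: \<iota>_tr \<iota>_simps(3) Tr_\<iota>_mult)

end

locale galois_dual_system = galois_tower \<kappa> \<iota>
  for \<kappa> :: "'k::field \<Rightarrow> 'a::field" and \<iota> :: "'a \<Rightarrow> 'b::field" +
  fixes J :: nat and b c :: "nat \<Rightarrow> 'b"
  assumes dual: "g \<in> G \<Longrightarrow> (\<Sum>j<J. b j * g (c j)) = (if g = id then 1 else 0)"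
begin

text \<open>Apply \<open>g\<close> to the duality relation for \<open>inv g\<close>: the roles of
  \<open>b\<close> and \<open>c\<close> are symmetric.\<close>

lemma dual': "g \<in> G \<Longrightarrow> (\<Sum>j<J. c j * g (b j)) = (if g = id then 1 else 0)"
proof -
  assume g: "g \<in> G"
  have "(\<Sum>j<J. c j * g (b j)) = g (\<Sum>j<J. b j * inv g (c j))"
    by (simp add: G_simps(3,8)[OF g] G_f_inv[OF g] mult.commute)
  moreover have "inv g = id \<longleftrightarrow> g = id"
    using inv_inv_eq[OF G_bij[OF g]] inv_id by metis
  ultimately show ?thesis
    using dual[OF inv_in_G[OF g]] by (simp add: G_simps(1,4)[OF g])
qed

text \<open>Writing out the trace and exchanging the sums leaves only \<open>g = id\<close>. Either
  of \<open>b\<close>, \<open>c\<close> thus spans \<open>L\<close> over \<open>K\<close>, with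
  traces against the other as coefficients.\<close>

lemma sum_Tr:
  assumes "\<And>g. g \<in> G \<Longrightarrow> (\<Sum>j<J. u j * g (v j)) = (if g = id then 1 else 0)"
  shows "(\<Sum>j<J. u j * Tr (v j * x)) = x"
proof -
  have "(\<Sum>j<J. u j * Tr (v j * x)) = (\<Sum>j<J. \<Sum>g\<in>G. u j * g (v j) * g x)"
    by (simp add: Tr_def sum_distrib_left G_simps(3) mult.assoc)
  also have "\<dots> = (\<Sum>g\<in>G. (\<Sum>j<J. u j * g (v j)) * g x)"
    by (simp only: sum_distrib_right) (rule sum.swap)
  also have "\<dots> = (\<Sum>g\<in>G. if g = id then x else 0)"
    by (rule sum.cong) (simp_all add: assms)
  also have "\<dots> = x"
    by (simp add: finite_G id_in_G)
  finally show ?thesis .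
qed

lemmas expansion_b = sum_Tr[OF dual] and expansion_c = sum_Tr[OF dual']

lemma sum_bc: "(\<Sum>j<J. b j * c j) = 1"
  using dual[OF id_in_G] by simp

section \<open>Extending differential operators\<close>

definition sep_avg :: "('b \<Rightarrow> 'b) \<Rightarrow> 'b \<Rightarrow> 'b" where
  "sep_avg T x = (\<Sum>j<J. b j * T (c j * x))"

abbreviation "nilK \<equiv> nil_comm (\<lambda>a x. \<iota> a * x) (\<lambda>a x. \<iota> a * x :: 'b)"

lemma additive_sep_avg: "additive T \<Longrightarrow> additive (sep_avg T)"
  by (simp add: additive_def sep_avg_def distrib_left sum.distrib)

lemma additive_commutator: "additive T \<Longrightarrow> additive (commutator T x)"
  by (simp add: additive_def commutator_def distrib_left)

text \<open>Multiplications in \<open>L\<close> commute with each other. Iterated averages can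
  therefore be handled by induction on commutators.\<close>

lemma commutator_sep_avg: "commutator (sep_avg T) x = sep_avg (commutator T x)"
  by (simp add: fun_eq_iff commutator_def sep_avg_def sum_distrib_left sum_subtractf algebra_simps)

lemma commutator_sep_avg_funpow:
  "commutator ((sep_avg ^^ n) T) x = (sep_avg ^^ n) (commutator T x)"
  by (induction n) (simp_all add: commutator_sep_avg)

text \<open>
  The element \<open>\<Sum>j. b j \<otimes> c j\<close> of \<open>L \<otimes>\<^sub>K L\<close> is the separability idempotent, so it is annihilated by
  \<open>1 \<otimes> x - x \<otimes> 1\<close>; over \<open>k\<close> this only holds up to commutators with elements of \<open>K\<close>.
\<close>

lemma commutator_sep_avg_eq:
  assumes "additive T"
  shows "commutator (sep_avg T) x y =
    (\<Sum>j<J. \<Sum>i<J. b j * commutator T (\<iota> (tr (b i * (c j * x)))) (c i * y))"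
proof -
  let ?m = "\<lambda>i j. tr (b i * (c j * x))"
  have *: "c j * (x * y) = (\<Sum>i<J. \<iota> (?m i j) * (c i * y))" for j
  proof -
    have "c j * x = (\<Sum>i<J. c i * Tr (b i * (c j * x)))"
      by (rule expansion_c[symmetric])
    then have "c j * x * y = (\<Sum>i<J. c i * Tr (b i * (c j * x))) * y"
      by simp
    then show ?thesis
      by (simp add: sum_distrib_left sum_distrib_right \<iota>_tr ac_simps)
  qed
  have "sep_avg T (x * y) = (\<Sum>j<J. \<Sum>i<J. b j * T (\<iota> (?m i j) * (c i * y)))"
    unfolding sep_avg_def * by (simp add: additive.sum[OF assms] sum_distrib_left)
  moreover have "x * sep_avg T y = (\<Sum>j<J. \<Sum>i<J. b j * (\<iota> (?m i j) * T (c i * y)))"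
  proof -
    \<comment> \<open>The same coefficients \<open>?m i j\<close> expand \<open>x * b i\<close> in
      the \<open>b j\<close> and \<open>c j * x\<close> in the \<open>c i\<close>, so the two double
      sums differ only in whether \<open>T\<close> is applied before or after multiplying by
      them.\<close>
    have "x * b i = (\<Sum>j<J. b j * \<iota> (?m i j))" for i
      using expansion_b[of "x * b i"] by (simp add: \<iota>_tr ac_simps)
    then have "x * sep_avg T y = (\<Sum>i<J. (\<Sum>j<J. b j * \<iota> (?m i j)) * T (c i * y))"
      by (simp add: sep_avg_def sum_distrib_left flip: mult.assoc)
    also have "\<dots> = (\<Sum>i<J. \<Sum>j<J. b j * (\<iota> (?m i j) * T (c i * y)))"
      by (simp add: sum_distrib_right mult.assoc)
    finally show ?thesis
      by (subst sum.swap)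
  qed
  ultimately show ?thesis
    by (simp add: commutator_def right_diff_distrib sum_subtractf)
qed

text \<open>By the preceding formula, a commutator of the average with an element of
  \<open>L\<close> is built from commutators of \<open>T\<close> with elements of \<open>K\<close>
  by \<open>K\<close>-linear multiplications, so the order over \<open>K\<close> drops.\<close>

lemma nilK_commutator_sep_avg:
  assumes "additive T" "nilK (Suc n) T"
  shows "nilK n (commutator (sep_avg T) x)"
proof -
  have add: "additive (\<lambda>x. \<iota> a * x)" for a
    by (rule additive_mult_left)
  have "nilK n (\<lambda>y. b j * commutator T (\<iota> a) (c i * y))" for a i j
  proof (rule nil_comm_comp_left[where V = "(*) (b j)", OF additive_mult_left])
    show "nilK n (\<lambda>y. commutator T (\<iota> a) (c i * y))"
      by (rule nil_comm_comp_right[where U = "(*) (c i)"])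
        (use assms(2) in \<open>auto simp: commutator_def ac_simps\<close>)
  qed (simp add: ac_simps)
  then show ?thesis
    unfolding commutator_sep_avg_eq[OF assms(1), abs_def]
    by (intro nil_comm_sum add)
qed

text \<open>Each averaging trades a commutator with \<open>L\<close> for one with \<open>K\<close>.
  The count is \<open>Suc n\<close> because a \<open>K\<close>-linear map still needs one averaging
  to become \<open>L\<close>-linear.\<close>

lemma nilL_sep_avg_funpow:
  "additive T \<Longrightarrow> nilK n T \<Longrightarrow> nil_comm (*) (*) n ((sep_avg ^^ Suc n) T)"
proof (induction n arbitrary: T)
  case 0
  then have "commutator T (\<iota> a) = (\<lambda>_. 0)" for a
    by (simp add: commutator_def)
  then have "commutator (sep_avg T) x y = 0" for x y
    unfolding commutator_sep_avg_eq[OF 0(1)] by simp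
  then show ?case
    by (simp add: commutator_def)
next
  case (Suc n)
  have "nil_comm (*) (*) n ((sep_avg ^^ Suc n) (commutator (sep_avg T) x))" for x
    by (intro Suc.IH nilK_commutator_sep_avg additive_commutator additive_sep_avg Suc.prems)
  then have "nil_comm (*) (*) n (commutator ((sep_avg ^^ Suc n) (sep_avg T)) x)" for x
    by (simp only: commutator_sep_avg_funpow)
  then show ?case
    by (simp add: commutator_def funpow_swap1)
qed

text \<open>
  Averaging \<open>Q \<circ> tr\<close> restores the leading term of \<open>Q\<close> because averaging the trace gives the
  identity of \<open>L\<close>.
\<close>

lemma nil_comm_restriction_defect:
  assumes "0 < m"
  shows "additive Q \<Longrightarrow> nil_comm (*) (\<lambda>a y. \<iota> a * y) (Suc n) Q \<Longrightarrow>
    nil_comm (*) (\<lambda>a y. \<iota> a * y) n (\<lambda>a. Q a - (sep_avg ^^ m) (\<lambda>x. Q (tr x)) (\<iota> a))"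
proof (induction n arbitrary: Q)
  let ?R = "\<lambda>Q a. Q a - (sep_avg ^^ m) (\<lambda>x. Q (tr x)) (\<iota> a)"
  \<comment> \<open>Forming the defect \<open>?R\<close> commutes with forming commutators, so
    everything reduces to \<open>K\<close>-linear \<open>Q\<close>.\<close>
  have comm: "?R Q (r * a) - \<iota> r * ?R Q a = ?R (\<lambda>a. Q (r * a) - \<iota> r * Q a) a" for Q r a
  proof -
    have "commutator (\<lambda>x. Q (tr x)) (\<iota> r) = (\<lambda>x. Q (r * tr x) - \<iota> r * Q (tr x))"
      by (simp add: commutator_def tr_\<iota>_mult)
    then have "(sep_avg ^^ m) (\<lambda>x. Q (r * tr x) - \<iota> r * Q (tr x)) (\<iota> a)
        = commutator ((sep_avg ^^ m) (\<lambda>x. Q (tr x))) (\<iota> r) (\<iota> a)"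
      by (simp only: commutator_sep_avg_funpow)
    then show ?thesis
      by (simp add: commutator_def \<iota>_simps(3) right_diff_distrib)
  qed
  {
    case 0
    \<comment> \<open>A \<open>K\<close>-linear \<open>Q\<close> is determined by
      \<open>Q 1\<close>. The first averaging turns \<open>Q \<circ> tr\<close> into
      \<open>x \<mapsto> x * Q 1\<close>, which further averagings fix; this is why
      \<open>0 < m\<close> is assumed.\<close>
    have zero: "?R Q a = 0" if Q: "\<And>r a. Q (r * a) = \<iota> r * Q a" for Q :: "'a \<Rightarrow> 'b" and a
    proof -
      have Q1: "Q a = \<iota> a * Q 1" for a
        using Q[of a 1] by simp
      have Q_tr: "Q (tr x) = Tr x * Q 1" for x
        using Q1[of "tr x"] by (simp only: \<iota>_tr)
      have step: "sep_avg (\<lambda>x. x * Q 1) = (\<lambda>x. x * Q 1)"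
      proof
        fix x
        have "sep_avg (\<lambda>x. x * Q 1) x = (\<Sum>j<J. b j * c j) * (x * Q 1)"
          by (simp add: sep_avg_def sum_distrib_right mult.assoc)
        then show "sep_avg (\<lambda>x. x * Q 1) x = x * Q 1"
          by (simp add: sum_bc)
      qed
      have "sep_avg (\<lambda>x. Q (tr x)) = (\<lambda>x. x * Q 1)"
      proof
        fix x
        have "sep_avg (\<lambda>x. Q (tr x)) x = (\<Sum>j<J. b j * Tr (c j * x)) * Q 1"
          unfolding sep_avg_def sum_distrib_right
          by (rule sum.cong) (simp_all add: Q_tr)
        then show "sep_avg (\<lambda>x. Q (tr x)) x = x * Q 1"
          by (simp add: expansion_b)
      qed
      moreover have "(sep_avg ^^ i) (\<lambda>x. x * Q 1) = (\<lambda>x. x * Q 1)" for i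
        by (induction i) (simp_all add: step)
      moreover obtain i where "m = Suc i"
        using assms gr0_implies_Suc by blast
      ultimately show ?thesis
        by (simp add: funpow_swap1 Q1[of a])
    qed
    have "?R (\<lambda>a. Q (r * a) - \<iota> r * Q a) a = 0" for r a
      by (rule zero) (use 0(2) in simp)
    then have "?R Q (r * a) = \<iota> r * ?R Q a" for r a
      unfolding comm[symmetric] by (simp only: right_minus_eq)
    then show ?case
      unfolding nil_comm.simps(1) by blast
  next
    case (Suc n)
    have "additive (\<lambda>a. Q (r * a) - \<iota> r * Q a)" for r
      using Suc.prems(1) by (simp add: additive_def algebra_simps)
    from Suc.IH[OF this] Suc.prems(2) show ?case
      by (simp add: comm[of Q])
  }
qed

text \<open>An average of \<open>Q \<circ> tr\<close> extends \<open>Q\<close> up to a defect of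
  lower order, which extends by induction. \<open>Q\<close> takes values in \<open>L\<close> because
  the defect does so even when \<open>Q\<close> comes from an operator on \<open>K\<close>.\<close>

lemma extension_exists:
  "additive Q \<Longrightarrow> (\<forall>r a. Q (\<kappa> r * a) = \<iota> (\<kappa> r) * Q a) \<Longrightarrow>
    nil_comm (*) (\<lambda>a y. \<iota> a * y) n Q \<Longrightarrow>
    \<exists>P\<in>diff_ops (\<iota> \<circ> \<kappa>). \<forall>a. P (\<iota> a) = Q a"
proof (induction n arbitrary: Q)
  case 0
  have "Q a = \<iota> a * Q 1" for a
    using 0(3)[unfolded nil_comm.simps, rule_format, of a 1] by simp
  then show ?case
    using diff_ops_mult[OF \<iota>\<kappa>, of "Q 1"] by (metis mult.commute)
next
  case (Suc n)
  define T where "T = (\<lambda>x. Q (tr x))"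
  \<comment> \<open>\<open>T\<close> has order at most \<open>Suc n\<close> over \<open>K\<close>,
    so one more averaging than that gives a differential operator on \<open>L\<close>.\<close>
  define P where "P = (sep_avg ^^ Suc (Suc n)) T"
  have "additive T"
    using Suc.prems(1) by (simp add: T_def additive_def tr_add)
  have "nilK (Suc n) T"
    unfolding T_def by (rule nil_comm_comp_right[OF _ Suc.prems(3)]) (rule tr_\<iota>_mult)
  have lin: "(sep_avg ^^ i) T (\<iota> (\<kappa> r) * x) = \<iota> (\<kappa> r) * (sep_avg ^^ i) T x" for i r x
  proof (induction i arbitrary: x)
    case 0
    show ?case by (simp add: T_def tr_\<iota>_mult Suc.prems(2))
  next
    case (Suc i)
    have "(sep_avg ^^ Suc i) T (\<iota> (\<kappa> r) * x)
        = (\<Sum>j<J. b j * (sep_avg ^^ i) T (\<iota> (\<kappa> r) * (c j * x)))"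
      by (simp add: sep_avg_def ac_simps)
    also have "\<dots> = \<iota> (\<kappa> r) * (sep_avg ^^ Suc i) T x"
      unfolding Suc by (simp add: sep_avg_def sum_distrib_left ac_simps)
    finally show ?case .
  qed
  have add: "additive ((sep_avg ^^ i) T)" for i
    by (induction i) (simp_all add: \<open>additive T\<close> additive_sep_avg)
  have P: "P \<in> diff_ops (\<iota> \<circ> \<kappa>)"
    unfolding diff_ops_iff[OF \<iota>\<kappa>] P_def o_apply
    using nilL_sep_avg_funpow[OF \<open>additive T\<close> \<open>nilK (Suc n) T\<close>] add lin by blast
  let ?Q = "\<lambda>a. Q a - P (\<iota> a)"
  have "additive ?Q"
    using Suc.prems(1) add[of "Suc (Suc n)", folded P_def]
    by (simp add: additive_def \<iota>_simps(2))
  moreover have "\<forall>r a. ?Q (\<kappa> r * a) = \<iota> (\<kappa> r) * ?Q a"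
    using Suc.prems(2) lin[of "Suc (Suc n)", folded P_def]
    by (simp add: \<iota>_simps(3) right_diff_distrib)
  moreover have "nil_comm (*) (\<lambda>a y. \<iota> a * y) n ?Q"
    using nil_comm_restriction_defect[OF _ Suc.prems(1,3), of "Suc (Suc n)"]
    by (simp only: P_def T_def zero_less_Suc)
  ultimately obtain P' where P': "P' \<in> diff_ops (\<iota> \<circ> \<kappa>)" "\<forall>a. P' (\<iota> a) = Q a - P (\<iota> a)"
    using Suc.IH by blast
  have "\<forall>a. P (\<iota> a) + P' (\<iota> a) = Q a"
    using P'(2) by simp
  then show ?case
    by (rule bexI[OF _ diff_ops_add[OF \<iota>\<kappa> P P'(1)]])
qed

section \<open>Uniqueness of the extension\<close>

text \<open>The commutators of \<open>P\<close> are multiplications by induction, and the average of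
  \<open>P\<close> is one because \<open>P\<close> commutes with \<open>K\<close>. \<open>P\<close>
  is a difference of such maps.\<close>

lemma K_linear_eq_mult:
  "additive P \<Longrightarrow> \<forall>a x. P (\<iota> a * x) = \<iota> a * P x \<Longrightarrow> nil_comm (*) (*) n P \<Longrightarrow> P x = P 1 * x"
proof (induction n arbitrary: P x)
  case 0
  have "P (x * 1) = x * P 1"
    using 0(3) unfolding nil_comm.simps by blast
  then show ?case
    by (simp add: mult.commute)
next
  case (Suc n)
  have comm: "commutator P y x = commutator P y 1 * x" for x y
  proof (rule Suc.IH)
    show "\<forall>a x. commutator P y (\<iota> a * x) = \<iota> a * commutator P y x"
      using Suc.prems(2)
      by (simp add: commutator_def right_diff_distrib mult.left_commute[of y])
    show "nil_comm (*) (*) n (commutator P y)"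
      using Suc.prems(3) by (simp add: commutator_def)
  qed (rule additive_commutator[OF Suc.prems(1)])
  have "commutator P (\<iota> a) = (\<lambda>_. 0)" for a
    using Suc.prems(2) by (simp add: commutator_def)
  then have "commutator (sep_avg P) x 1 = 0"
    unfolding commutator_sep_avg_eq[OF Suc.prems(1)] by simp
  then have avg: "sep_avg P x = sep_avg P 1 * x"
    by (simp add: commutator_def mult.commute)
  \<comment> \<open>Moving \<open>c j\<close> out of \<open>P (c j * x)\<close> costs a commutator
    and leaves \<open>P x\<close> with the factor \<open>(\<Sum>j<J. b j * c j) = 1\<close>.\<close>
  have *: "sep_avg P x = (\<Sum>j<J. b j * commutator P (c j) 1) * x + P x" for x
  proof -
    have "sep_avg P x = (\<Sum>j<J. b j * commutator P (c j) x) + (\<Sum>j<J. b j * c j) * P x"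
      by (simp add: sep_avg_def commutator_def sum_distrib_right sum_subtractf right_diff_distrib mult.assoc)
    also have "(\<Sum>j<J. b j * commutator P (c j) x) = (\<Sum>j<J. b j * commutator P (c j) 1) * x"
      by (subst comm) (simp add: sum_distrib_right mult.assoc)
    finally show ?thesis
      by (simp add: sum_bc)
  qed
  from avg show ?case
    unfolding *[of x] *[of 1] by (simp add: algebra_simps)
qed

text \<open>Commutators with \<open>K\<close> also vanish on \<open>K\<close>, hence are zero by
  induction. So \<open>P\<close> is \<open>K\<close>-linear, that is, multiplication by
  \<open>P 1 = 0\<close>.\<close>

lemma eq_zero_if_zero_on_K:
  "additive P \<Longrightarrow> nil_comm (*) (*) n P \<Longrightarrow> \<forall>a. P (\<iota> a) = 0 \<Longrightarrow> P x = 0"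
proof (induction n arbitrary: P x)
  case 0
  have "P (x * \<iota> 1) = x * P (\<iota> 1)"
    using 0(2) unfolding nil_comm.simps by blast
  then show ?case
    using 0(3)[rule_format, of 1] by (simp add: \<iota>_simps(1))
next
  case (Suc n)
  have "commutator P (\<iota> a) x = 0" for a x
    using Suc.prems Suc.IH[of "commutator P (\<iota> a)" x] additive_commutator[OF Suc.prems(1), of "\<iota> a"]
    by (simp add: commutator_def flip: \<iota>_simps(3))
  then have "\<forall>a x. P (\<iota> a * x) = \<iota> a * P x"
    by (simp add: commutator_def)
  then show ?case
    using K_linear_eq_mult[OF Suc.prems(1) _ Suc.prems(2), of x] Suc.prems(3)[rule_format, of 1]
    by (simp add: \<iota>_simps(1))
qed

lemma diff_ops_eqI:
  assumes "P \<in> diff_ops (\<iota> \<circ> \<kappa>)" "P' \<in> diff_ops (\<iota> \<circ> \<kappa>)" "\<And>a. P (\<iota> a) = P' (\<iota> a)"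
  shows "P = P'"
proof
  fix x
  have "(\<lambda>x. P x + (*) (- 1) (P' x)) \<in> diff_ops (\<iota> \<circ> \<kappa>)"
    using diff_ops_add[OF \<iota>\<kappa> assms(1) diff_ops_comp[OF \<iota>\<kappa> diff_ops_mult[OF \<iota>\<kappa>, of "- 1"] assms(2)]]
    by (simp only: o_def)
  then obtain n where "additive (\<lambda>x. P x - P' x)" "nil_comm (*) (*) n (\<lambda>x. P x - P' x)"
    unfolding diff_ops_iff[OF \<iota>\<kappa>] by auto
  from eq_zero_if_zero_on_K[OF this] show "P x = P' x"
    using assms(3) by simp
qed

section \<open>The canonical inclusion of the operators on \<open>K\<close>\<close>

abbreviation "ext \<equiv> diff_op_extension \<kappa> \<iota>"

lemma ext_eqI:
  assumes "P \<in> diff_ops (\<iota> \<circ> \<kappa>)" "\<And>a. P (\<iota> a) = \<iota> (Q a)"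
  shows "ext Q = P"
  unfolding diff_op_extension_def
  using assms by (intro the_equality) (auto intro: diff_ops_eqI)

lemma ext:
  assumes "Q \<in> diff_ops \<kappa>"
  shows ext_in_diff_ops: "ext Q \<in> diff_ops (\<iota> \<circ> \<kappa>)" and ext_\<iota>: "ext Q (\<iota> a) = \<iota> (Q a)"
proof -
  from assms obtain n where Q: "additive Q" "\<forall>c x. Q (\<kappa> c * x) = \<kappa> c * Q x" "nil_comm (*) (*) n Q"
    unfolding diff_ops_iff[OF \<kappa>] by blast
  have "nil_comm (*) (\<lambda>a y. \<iota> a * y) n (\<lambda>a. \<iota> (Q a))"
    by (rule nil_comm_comp_left[OF _ _ Q(3)]) (simp_all add: additive_def \<iota>_simps(2,3))
  then obtain P where P: "P \<in> diff_ops (\<iota> \<circ> \<kappa>)" "\<And>a. P (\<iota> a) = \<iota> (Q a)"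
    using extension_exists[of "\<lambda>a. \<iota> (Q a)" n] Q(1,2) by (auto simp: additive_def \<iota>_simps(2,3))
  then show "ext Q \<in> diff_ops (\<iota> \<circ> \<kappa>)" "ext Q (\<iota> a) = \<iota> (Q a)"
    using ext_eqI[OF P] by auto
qed

text \<open>Expand \<open>P (\<iota> a)\<close> in the \<open>b j\<close>: its coefficients
  \<open>tr (c j * P (\<iota> a))\<close> are differential operators in \<open>a\<close>. Both sides
  then agree on \<open>K\<close>, and uniqueness applies.\<close>

lemma diff_ops_decomposition:
  assumes "P \<in> diff_ops (\<iota> \<circ> \<kappa>)"
  shows "\<exists>Q. (\<forall>j. Q j \<in> diff_ops \<kappa>) \<and> P = (\<lambda>x. \<Sum>j<J. b j * ext (Q j) x)"
proof -
  from assms obtain n where P: "additive P" "\<forall>r x. P (\<iota> (\<kappa> r) * x) = \<iota> (\<kappa> r) * P x"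
    "nil_comm (*) (*) n P"
    unfolding diff_ops_iff[OF \<iota>\<kappa>] by auto
  define Q where "Q = (\<lambda>j a. tr (c j * P (\<iota> a)))"
  have Q: "Q j \<in> diff_ops \<kappa>" for j
  proof -
    have "nil_comm (*) (\<lambda>a y. \<iota> a * y) n (\<lambda>a. P (\<iota> a))"
      by (rule nil_comm_comp_right[OF _ nil_comm_restrict[OF P(3)]]) (rule \<iota>_simps(3))
    then have "nil_comm (*) (*) n (\<lambda>a. tr (c j * P (\<iota> a)))"
      by (rule nil_comm_comp_left[where V = "\<lambda>y. tr (c j * y)", rotated 2])
        (simp_all add: additive_def distrib_left tr_add mult.left_commute[of "c j"] tr_\<iota>_mult)
    then show ?thesis
      unfolding diff_ops_iff[OF \<kappa>] Q_def using P(1,2)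
      by (auto simp: additive_def distrib_left tr_add \<iota>_simps(2,3) mult.left_commute[of "c j"] tr_\<iota>_mult)
  qed
  moreover have "P = (\<lambda>x. \<Sum>j<J. b j * ext (Q j) x)"
  proof (rule diff_ops_eqI[OF assms])
    show "(\<lambda>x. \<Sum>j<J. b j * ext (Q j) x) \<in> diff_ops (\<iota> \<circ> \<kappa>)"
      using diff_ops_comp[OF \<iota>\<kappa> diff_ops_mult[OF \<iota>\<kappa>] ext_in_diff_ops[OF Q]]
      by (intro diff_ops_sum[OF \<iota>\<kappa>]) (simp add: o_def)
    show "P (\<iota> a) = (\<Sum>j<J. b j * ext (Q j) (\<iota> a))" for a
      unfolding ext_\<iota>[OF Q] by (simp add: Q_def \<iota>_tr expansion_b)
  qed
  ultimately show ?thesis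
    by blast
qed

text \<open>Commutators transform by
  \<open>[g P g\<inverse>, r] = g [P, g\<inverse> r] g\<inverse>\<close>, so the order is
  preserved.\<close>

lemma conj_in_diff_ops:
  assumes "g \<in> G" "P \<in> diff_ops (\<iota> \<circ> \<kappa>)"
  shows "g \<circ> P \<circ> inv g \<in> diff_ops (\<iota> \<circ> \<kappa>)"
proof -
  note g = G_simps[OF assms(1)] and g' = G_simps[OF inv_in_G[OF assms(1)]]
  from assms(2) obtain n where P: "additive P" "\<forall>r x. P (\<iota> (\<kappa> r) * x) = \<iota> (\<kappa> r) * P x"
    "nil_comm (*) (*) n P"
    unfolding diff_ops_iff[OF \<iota>\<kappa>] by auto
  have "nil_comm (\<lambda>r. (*) (inv g r)) (*) n (\<lambda>x. g (P x))"
    by (rule nil_comm_comp_left[OF _ _ nil_comm_restrict[OF P(3)]])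
      (simp_all add: additive_def g(2,3) G_f_inv[OF assms(1)])
  then have "nil_comm (*) (*) n (\<lambda>x. g (P (inv g x)))"
    by (rule nil_comm_comp_right[rotated]) (rule g'(3))
  then show ?thesis
    unfolding diff_ops_iff[OF \<iota>\<kappa>] using P(1,2)
    by (auto simp: o_def additive_def g(2,3) g'(2,3) G_fix[OF assms(1)] G_fix[OF inv_in_G[OF assms(1)]])
qed

text \<open>Since \<open>g\<close> fixes \<open>K\<close>, both sides extend \<open>Q\<close>. Hence
  all twists of \<open>M\<close> have the same direct image.\<close>

lemma conj_ext:
  assumes "g \<in> G" "Q \<in> diff_ops \<kappa>"
  shows "g \<circ> ext Q \<circ> inv g = ext Q"
  by (rule ext_eqI[symmetric])
    (simp_all add: conj_in_diff_ops[OF assms(1) ext_in_diff_ops[OF assms(2)]]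
      ext_\<iota>[OF assms(2)] G_fix[OF assms(1)] G_fix[OF inv_in_G[OF assms(1)]])

section \<open>Direct images of modules\<close>

lemma ext_id: "ext id = id"
  by (rule ext_eqI) (simp_all add: diff_ops_id[OF \<iota>\<kappa>])

lemma ext_mult: "ext ((*) a) = (*) (\<iota> a)"
  by (rule ext_eqI) (simp_all add: diff_ops_mult[OF \<iota>\<kappa>] \<iota>_simps(3))

lemma ext_add:
  assumes "P \<in> diff_ops \<kappa>" "Q \<in> diff_ops \<kappa>"
  shows "ext (\<lambda>a. P a + Q a) = (\<lambda>x. ext P x + ext Q x)"
  by (rule ext_eqI) (simp_all add: diff_ops_add[OF \<iota>\<kappa>] ext_in_diff_ops ext_\<iota> assms \<iota>_simps(2))

lemma ext_comp:
  assumes "P \<in> diff_ops \<kappa>" "Q \<in> diff_ops \<kappa>"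
  shows "ext (P \<circ> Q) = ext P \<circ> ext Q"
  by (rule ext_eqI) (simp_all add: diff_ops_comp[OF \<iota>\<kappa>] ext_in_diff_ops ext_\<iota> assms)

lemma op_module_direct_image:
  assumes "op_module (diff_ops (\<iota> \<circ> \<kappa>)) act"
  shows "op_module (diff_ops \<kappa>) (direct_image \<kappa> \<iota> act)"
  using assms ext_in_diff_ops
  by (simp add: op_module_def direct_image_def ext_id ext_add ext_comp)

end

section \<open>Submodules of the direct image and their induced modules\<close>

locale galois_dual_system_module = galois_dual_system \<kappa> \<iota> J b c
  for \<kappa> :: "'k::field \<Rightarrow> 'a::field" and \<iota> :: "'a \<Rightarrow> 'b::field" and J and b c :: "nat \<Rightarrow> 'b" +
  fixes act :: "('b \<Rightarrow> 'b) \<Rightarrow> 'm::ab_group_add \<Rightarrow> 'm"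
  assumes op_module: "op_module (diff_ops (\<iota> \<circ> \<kappa>)) act"
begin

abbreviation "D \<equiv> diff_ops (\<iota> \<circ> \<kappa>)"

lemma act_add: "P \<in> D \<Longrightarrow> act P (m + n) = act P m + act P n"
  and act_op_add: "P \<in> D \<Longrightarrow> Q \<in> D \<Longrightarrow> act (\<lambda>x. P x + Q x) m = act P m + act Q m"
  and act_comp: "P \<in> D \<Longrightarrow> Q \<in> D \<Longrightarrow> act (P \<circ> Q) m = act P (act Q m)"
  using op_module by (simp_all add: op_module_def)

lemma additive_act: "P \<in> D \<Longrightarrow> additive (act P)"
  by (simp add: additive_def act_add)

lemmas act_zero = additive.zero[OF additive_act]
  and act_minus = additive.minus[OF additive_act]
  and act_diff = additive.diff[OF additive_act]

lemma act_op_zero: "act (\<lambda>_. 0) m = 0"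
  using act_op_add[OF diff_ops_zero[OF \<iota>\<kappa>] diff_ops_zero[OF \<iota>\<kappa>], of m] by simp

lemma act_op_sum:
  "(\<And>i. i \<in> I \<Longrightarrow> P i \<in> D) \<Longrightarrow> act (\<lambda>x. \<Sum>i\<in>I. P i x) m = (\<Sum>i\<in>I. act (P i) m)"
  by (induction I rule: infinite_finite_induct)
    (simp_all add: act_op_zero act_op_add diff_ops_sum[OF \<iota>\<kappa>])

lemma mult_in_D: "(*) x \<in> D"
  by (rule diff_ops_mult[OF \<iota>\<kappa>])

text \<open>
  The image of \<open>L \<otimes>\<^sub>K N\<close> under \<open>L \<otimes>\<^sub>K M \<cong> (\<Oplus>g\<in>G. M)\<close>, \<open>l \<otimes> m \<mapsto> (g(l) m)\<^sub>g\<close>; values outside \<open>G\<close> are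
  unconstrained.
\<close>

inductive_set induced :: "'m set \<Rightarrow> (('b \<Rightarrow> 'b) \<Rightarrow> 'm) set" for N where
  zero: "\<forall>g\<in>G. w g = 0 \<Longrightarrow> w \<in> induced N"
| step: "v \<in> induced N \<Longrightarrow> n \<in> N \<Longrightarrow> \<forall>g\<in>G. w g = act ((*) (g l)) n + v g \<Longrightarrow> w \<in> induced N"

context
  fixes N
  assumes N: "op_submodule (diff_ops \<kappa>) (direct_image \<kappa> \<iota> act) N"
begin

lemma N_zero: "0 \<in> N"
  and N_diff: "m \<in> N \<Longrightarrow> n \<in> N \<Longrightarrow> m - n \<in> N"
  and N_ext: "Q \<in> diff_ops \<kappa> \<Longrightarrow> n \<in> N \<Longrightarrow> act (ext Q) n \<in> N"
  using N by (auto simp: op_submodule_def direct_image_def)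

lemma N_minus: "n \<in> N \<Longrightarrow> - n \<in> N"
  using N_diff[OF N_zero, of n] by simp

lemma N_add: "m \<in> N \<Longrightarrow> n \<in> N \<Longrightarrow> m + n \<in> N"
  using N_diff[OF _ N_minus, of m n] by simp

lemma induced_diff:
  "w \<in> induced N \<Longrightarrow> u \<in> induced N \<Longrightarrow> (\<lambda>g. u g - w g) \<in> induced N"
proof (induction rule: induced.induct)
  case (zero w)
  \<comment> \<open>The difference agrees with \<open>u\<close> on \<open>G\<close>, so the last
    rule in the derivation of \<open>u\<close> also derives the difference.\<close>
  from zero(2) show ?case
  proof cases
    case zero
    with \<open>\<forall>g\<in>G. w g = 0\<close> show ?thesis
      by (intro induced.zero) simp
  next
    case (step v n l)
    with \<open>\<forall>g\<in>G. w g = 0\<close> show ?thesis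
      by (intro induced.step[OF step(1,2), of _ l]) simp
  qed
next
  case (step v n w l)
  show ?case
    by (rule induced.step[OF step.IH[OF step.prems] N_minus[OF step.hyps(2)], of _ l])
      (simp add: step.hyps(3) act_minus[OF mult_in_D])
qed

lemma induced_sum:
  assumes "finite I" "\<And>i. i \<in> I \<Longrightarrow> n i \<in> N" "v \<in> induced N"
  shows "(\<lambda>g. (\<Sum>i\<in>I. act ((*) (g (l i))) (n i)) + v g) \<in> induced N"
  using assms(1,2)
proof (induction I)
  case (insert i I)
  have "(\<lambda>g. (\<Sum>i\<in>I. act ((*) (g (l i))) (n i)) + v g) \<in> induced N"
    using insert by simp
  then show ?case
    by (rule induced.step[of _ _ "n i" _ "l i"]) (use insert in \<open>auto simp: add.assoc\<close>)
qed (simp add: assms(3))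

lemma induced_act:
  assumes P: "P \<in> D"
  shows "w \<in> induced N \<Longrightarrow> (\<lambda>g. act (g \<circ> P \<circ> inv g) (w g)) \<in> induced N"
proof (induction rule: induced.induct)
  case (zero w)
  then show ?case
    using act_zero[OF conj_in_diff_ops[OF _ P]] by (intro induced.zero) (auto simp: o_def)
next
  case (step v n w l)
  from diff_ops_decomposition[OF diff_ops_comp[OF \<iota>\<kappa> P mult_in_D[of l]]]
  obtain Q where Q: "\<And>j. Q j \<in> diff_ops \<kappa>" "P \<circ> (*) l = (\<lambda>x. \<Sum>j<J. b j * ext (Q j) x)"
    by blast
  have eq: "act (g \<circ> P \<circ> inv g) (w g) =
      (\<Sum>j<J. act ((*) (g (b j))) (act (ext (Q j)) n)) + act (g \<circ> P \<circ> inv g) (v g)"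
    if g: "g \<in> G" for g
  proof -
    have "(g \<circ> P \<circ> inv g) \<circ> (*) (g l) = g \<circ> (P \<circ> (*) l) \<circ> inv g"
      by (simp add: fun_eq_iff G_simps(3)[OF inv_in_G[OF g]] G_inv_f[OF g])
    also have "\<dots> = (\<lambda>x. \<Sum>j<J. g (b j) * (g \<circ> ext (Q j) \<circ> inv g) x)"
      by (simp add: Q(2) fun_eq_iff G_simps(3,8)[OF g])
    also have "\<dots> = (\<lambda>x. \<Sum>j<J. ((*) (g (b j)) \<circ> ext (Q j)) x)"
      by (simp add: conj_ext[OF g Q(1)])
    finally have "act ((g \<circ> P \<circ> inv g) \<circ> (*) (g l)) n
        = (\<Sum>j<J. act ((*) (g (b j)) \<circ> ext (Q j)) n)"
      by (simp only: act_op_sum[OF diff_ops_comp[OF \<iota>\<kappa> mult_in_D ext_in_diff_ops[OF Q(1)]]])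
    moreover have "w g = act ((*) (g l)) n + v g"
      using step.hyps(3) g by blast
    ultimately show ?thesis
      by (simp only: act_add[OF conj_in_diff_ops[OF g P]] act_comp[OF conj_in_diff_ops[OF g P] mult_in_D]
          act_comp[OF mult_in_D ext_in_diff_ops[OF Q(1)]])
  qed
  let ?u = "\<lambda>g. (\<Sum>j<J. act ((*) (g (b j))) (act (ext (Q j)) n)) + act (g \<circ> P \<circ> inv g) (v g)"
  have "?u \<in> induced N"
    by (intro induced_sum step.IH N_ext Q(1) step.hyps(2)) simp
  \<comment> \<open>Adding \<open>0 \<otimes> 0\<close> replaces \<open>?u\<close> by a function
    equal to it only on \<open>G\<close>.\<close>
  then show ?case
    by (rule induced.step[OF _ N_zero, of _ _ 0]) (rule ballI, simp only: eq act_zero[OF mult_in_D] add_0)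
qed

text \<open>The coordinates of \<open>l \<otimes> n\<close> add up to \<open>tr l\<close> times
  \<open>n\<close>, and \<open>tr l\<close> lies in \<open>K\<close>.\<close>

lemma sum_induced: "w \<in> induced N \<Longrightarrow> (\<Sum>g\<in>G. w g) \<in> N"
proof (induction rule: induced.induct)
  case (step v n w l)
  have "(\<Sum>g\<in>G. act ((*) (g l)) n) = act (\<lambda>x. \<Sum>g\<in>G. g l * x) n"
    by (rule act_op_sum[OF mult_in_D, symmetric])
  also have "(\<lambda>x. \<Sum>g\<in>G. g l * x) = ext ((*) (tr l))"
    by (simp add: ext_mult \<iota>_tr Tr_def sum_distrib_right fun_eq_iff)
  finally have "(\<Sum>g\<in>G. act ((*) (g l)) n) \<in> N"
    using N_ext[OF diff_ops_mult[OF \<kappa>] step.hyps(2)] by simp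
  then show ?case
    using step by (simp add: sum.distrib N_add)
qed (simp add: N_zero)

definition supp :: "(('b \<Rightarrow> 'b) \<Rightarrow> 'm) \<Rightarrow> ('b \<Rightarrow> 'b) set" where
  "supp w = {g \<in> G. w g \<noteq> 0}"

text \<open>
  Vectors of minimal support \<open>S\<close> project injectively, hence by simplicity of \<open>M\<close> bijectively, to
  each coordinate in \<open>S\<close>; two coordinates \<open>g \<noteq> h\<close> would yield an isomorphism between twists of \<open>M\<close>.
\<close>

lemma single_coordinate:
  assumes simple: "simple_op_module D act" and inertia: "inertia_group \<kappa> \<iota> act = {id}"
    and "N \<noteq> {0}"
  shows "\<exists>g\<in>G. \<exists>w\<in>induced N. w g = m \<and> supp w \<subseteq> {g}"
proof -
  obtain n where n: "n \<in> N" "n \<noteq> 0"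
    using assms(3) N_zero by blast
  \<comment> \<open>The vector \<open>1 \<otimes> n\<close>, whose coordinate at \<open>id\<close>
    is \<open>n \<noteq> 0\<close>.\<close>
  have "(\<lambda>g. act ((*) (g 1)) n) \<in> induced N"
    by (rule induced.step[OF induced.zero n(1), of "\<lambda>_. 0" _ 1]) simp_all
  moreover have "act ((*) (id 1)) n = n"
  proof -
    have "(*) (id (1::'b)) = id"
      by (simp add: fun_eq_iff)
    then show ?thesis
      using op_module by (simp only: op_module_def)
  qed
  ultimately have "\<exists>w. w \<in> induced N \<and> supp w \<noteq> {}"
    using n(2) id_in_G unfolding supp_def by (intro exI[of _ "\<lambda>g. act ((*) (g 1)) n"]) auto
  then obtain w0 where w0: "w0 \<in> induced N" "supp w0 \<noteq> {}"
    and min: "\<And>w. w \<in> induced N \<Longrightarrow> supp w \<noteq> {} \<Longrightarrow> card (supp w0) \<le> card (supp w)"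
    using ex_has_least_nat[of "\<lambda>w. w \<in> induced N \<and> supp w \<noteq> {}" _ "\<lambda>w. card (supp w)"] by blast
  define S where "S = supp w0"
  define V where "V = {w \<in> induced N. supp w \<subseteq> S}"
  have "S \<subseteq> G" "finite S"
    using finite_G by (auto simp: S_def supp_def)
  have V_zero: "(\<lambda>_. 0) \<in> V"
    by (auto simp: V_def supp_def intro: induced.zero)
  have V_diff: "(\<lambda>g. u g - w g) \<in> V" if "u \<in> V" "w \<in> V" for u w
    using that induced_diff[of w u] unfolding V_def supp_def by force
  have V_add: "(\<lambda>g. u g + w g) \<in> V" if "u \<in> V" "w \<in> V" for u w
    using V_diff[OF that(1) V_diff[OF V_zero that(2)]] by simp
  have V_act: "(\<lambda>g. act (g \<circ> P \<circ> inv g) (w g)) \<in> V" if "P \<in> D" "w \<in> V" for P w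
  proof -
    have "act (g \<circ> P \<circ> inv g) 0 = 0" if "g \<in> G" for g
      by (rule act_zero[OF conj_in_diff_ops[OF that \<open>P \<in> D\<close>]])
    then show ?thesis
      using that induced_act[of P w] unfolding V_def supp_def by force
  qed
  \<comment> \<open>A vector in \<open>V\<close> that vanishes somewhere on \<open>S\<close> but not
    everywhere would have smaller nonempty support.\<close>
  have V_zero_at: "w h = 0" if "w \<in> V" "g \<in> S" "w g = 0" "h \<in> S" for w g h
  proof (rule ccontr)
    assume "w h \<noteq> 0"
    with that \<open>S \<subseteq> G\<close> have "supp w \<noteq> {}"
      by (auto simp: supp_def)
    with min[of w] that(1) have "card S \<le> card (supp w)"
      by (simp add: V_def S_def)
    moreover have "supp w \<subset> S"
      using that by (auto simp: V_def supp_def)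
    ultimately show False
      using psubset_card_mono[OF \<open>finite S\<close>] by (meson leD)
  qed
  have V_eq_at: "u h = w h" if "u \<in> V" "w \<in> V" "g \<in> S" "u g = w g" "h \<in> S" for u w g h
    using V_zero_at[OF V_diff[OF that(1,2)] that(3) _ that(5)] that(4) by simp
  have V_surj: "\<exists>w\<in>V. w g = m" if "g \<in> S" for g m
  proof -
    have g: "g \<in> G"
      using that \<open>S \<subseteq> G\<close> by blast
    have "op_submodule D act ((\<lambda>w. w g) ` V)"
      unfolding op_submodule_def
    proof (intro conjI ballI)
      show "0 \<in> (\<lambda>w. w g) ` V"
        using V_zero by (rule rev_image_eqI) simp
    next
      fix m n assume "m \<in> (\<lambda>w. w g) ` V" "n \<in> (\<lambda>w. w g) ` V"
      then show "m - n \<in> (\<lambda>w. w g) ` V"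
        using V_diff by (force intro: rev_image_eqI)
    next
      fix P m assume "P \<in> D" "m \<in> (\<lambda>w. w g) ` V"
      then obtain w where w: "w \<in> V" "m = w g"
        by blast
      \<comment> \<open>Acting by this conjugate induces exactly \<open>P\<close> on coordinate
        \<open>g\<close>.\<close>
      have "inv g \<circ> P \<circ> g \<in> D"
        using conj_in_diff_ops[OF inv_in_G[OF g] \<open>P \<in> D\<close>] by (simp add: inv_inv_eq[OF G_bij[OF g]])
      moreover have "g \<circ> (inv g \<circ> P \<circ> g) \<circ> inv g = P"
        by (simp add: fun_eq_iff G_f_inv[OF g])
      ultimately have "(\<lambda>h. act (h \<circ> (inv g \<circ> P \<circ> g) \<circ> inv h) (w h)) \<in> V"
          "act P m = act (g \<circ> (inv g \<circ> P \<circ> g) \<circ> inv g) (w g)"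
        using V_act[OF _ w(1)] w(2) by simp_all
      then show "act P m \<in> (\<lambda>w. w g) ` V"
        by (metis (no_types, lifting) rev_image_eqI)
    qed
    moreover have "w0 \<in> V" "w0 g \<noteq> 0"
      using w0(1) that by (auto simp: V_def S_def supp_def)
    ultimately have "(\<lambda>w. w g) ` V = UNIV"
      using simple unfolding simple_op_module_def by blast
    then show ?thesis
      by (metis UNIV_I imageE)
  qed
  have "g = h" if "g \<in> S" "h \<in> S" for g h
  proof -
    have g: "g \<in> G" and h: "h \<in> G"
      using that \<open>S \<subseteq> G\<close> by auto
    \<comment> \<open>On coordinates \<open>g\<close> and \<open>h\<close>, \<open>V\<close> is the
      graph of \<open>\<phi>\<close>; by \<open>V_eq_at\<close> the chosen \<open>w\<close> does not
      matter.\<close>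
    define \<phi> where "\<phi> m = (SOME w. w \<in> V \<and> w g = m) h" for m
    have \<phi>: "\<phi> (w g) = w h" if "w \<in> V" for w
    proof -
      have "\<exists>u. u \<in> V \<and> u g = w g"
        using that by blast
      from someI_ex[OF this] show ?thesis
        unfolding \<phi>_def using V_eq_at[OF _ that \<open>g \<in> S\<close> _ \<open>h \<in> S\<close>] by blast
    qed
    have "op_module_iso D (twisted_action (h \<circ> inv g) act) act"
      unfolding op_module_iso_def
    proof (intro exI[of _ \<phi>] conjI allI ballI)
      show "bij \<phi>"
      proof (rule bijI)
        show "inj \<phi>"
        proof (rule injI)
          fix m n assume "\<phi> m = \<phi> n"
          moreover obtain u w where "u \<in> V" "u g = m" "w \<in> V" "w g = n"
            using V_surj[OF \<open>g \<in> S\<close>] by metis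
          ultimately show "m = n"
            using \<phi> V_eq_at[OF _ _ \<open>h \<in> S\<close> _ \<open>g \<in> S\<close>, of u w] by auto
        qed
        show "surj \<phi>"
          unfolding surj_def using V_surj[OF \<open>h \<in> S\<close>] \<phi> by metis
      qed
    next
      fix m n
      obtain u w where "u \<in> V" "u g = m" "w \<in> V" "w g = n"
        using V_surj[OF \<open>g \<in> S\<close>] by metis
      then show "\<phi> (m + n) = \<phi> m + \<phi> n"
        using \<phi>[OF V_add, of u w] \<phi> by auto
    next
      fix P m assume "P \<in> D"
      obtain w where w: "w \<in> V" "w g = m"
        using V_surj[OF \<open>g \<in> S\<close>] by metis
      \<comment> \<open>Chosen to act as \<open>P\<close> on coordinate \<open>h\<close>; on
        coordinate \<open>g\<close> it then acts as \<open>P\<close> twisted by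
        \<open>h \<circ> inv g\<close>.\<close>
      let ?P = "inv h \<circ> P \<circ> h"
      have "?P \<in> D"
        using conj_in_diff_ops[OF inv_in_G[OF h] \<open>P \<in> D\<close>] by (simp add: inv_inv_eq[OF G_bij[OF h]])
      from \<phi>[OF V_act[OF this w(1)]]
      have "\<phi> (act (g \<circ> ?P \<circ> inv g) m) = act (h \<circ> ?P \<circ> inv h) (\<phi> m)"
        using \<phi>[OF w(1)] w(2) by simp
      moreover have "h \<circ> ?P \<circ> inv h = P"
        by (simp add: fun_eq_iff G_f_inv[OF h])
      moreover have "inv (h \<circ> inv g) = g \<circ> inv h"
        by (simp add: o_inv_distrib bij_imp_bij_inv G_bij g h inv_inv_eq)
      ultimately show "\<phi> (twisted_action (h \<circ> inv g) act P m) = act P (\<phi> m)"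
        by (simp add: twisted_action_def comp_assoc)
    qed
    then have "h \<circ> inv g \<in> inertia_group \<kappa> \<iota> act"
      by (simp add: inertia_group_def comp_in_G inv_in_G g h)
    then have "h \<circ> inv g = id"
      using inertia by simp
    then have "h (inv g (g x)) = g x" for x
      by (simp add: fun_eq_iff)
    then show "g = h"
      by (simp add: fun_eq_iff G_inv_f[OF g])
  qed
  moreover obtain g where "g \<in> S"
    using w0(2) by (auto simp: S_def)
  ultimately have "S \<subseteq> {g}"
    by blast
  then show ?thesis
    using V_surj[OF \<open>g \<in> S\<close>, of m] \<open>g \<in> S\<close> \<open>S \<subseteq> G\<close> unfolding V_def by blast
qed

text \<open>For each \<open>m\<close>, a vector concentrated at one \<open>g\<close> with coordinate
  \<open>m\<close> has coordinate sum \<open>m\<close>, which lies in \<open>N\<close>.\<close>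

lemma eq_UNIV:
  assumes "simple_op_module D act" "inertia_group \<kappa> \<iota> act = {id}" "N \<noteq> {0}"
  shows "N = UNIV"
proof -
  have "m \<in> N" for m
  proof -
    obtain g w where g: "g \<in> G" and w: "w \<in> induced N" "w g = m" "supp w \<subseteq> {g}"
      using single_coordinate[OF assms] by blast
    have "(\<Sum>h\<in>G. w h) = (\<Sum>h\<in>{g}. w h)"
      by (rule sum.mono_neutral_right) (use g w(3) finite_G in \<open>auto simp: supp_def\<close>)
    then show ?thesis
      using sum_induced[OF w(1)] w(2) by simp
  qed
  then show ?thesis
    by blast
qed

end

end

theorem proposition3p9:
  fixes \<kappa> :: "'k::{alg_closed_field, field_char_0} \<Rightarrow> 'a::field"
    and \<iota> :: "'a \<Rightarrow> 'b::field"
    and act :: "('b \<Rightarrow> 'b) \<Rightarrow> 'm::ab_group_add \<Rightarrow> 'm"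
  assumes "field_embedding \<kappa>"
    and "field_embedding \<iota>"
    and "fin_gen_extension \<kappa>"
    and "fin_gen_extension (\<iota> \<circ> \<kappa>)"
    and "finite_galois_extension \<iota>"
    and "simple_op_module (diff_ops (\<iota> \<circ> \<kappa>)) act"
    and "finite_dim_module act"
    and "inertia_group \<kappa> \<iota> act = {id}"
  shows "simple_op_module (diff_ops \<kappa>) (direct_image \<kappa> \<iota> act)"
proof -
  interpret galois_tower \<kappa> \<iota>
    using assms by unfold_locales
  obtain J :: nat and b c where "\<forall>g\<in>G. (\<Sum>j<J. b j * g (c j)) = (if g = id then 1 else 0)"
    using dual_system_exists by blast
  moreover have "op_module (diff_ops (\<iota> \<circ> \<kappa>)) act"
    using assms(6) by (simp add: simple_op_module_def)
  ultimately interpret galois_dual_system_module \<kappa> \<iota> J b c act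
    by unfold_locales blast+
  show ?thesis
    using op_module_direct_image[OF op_module] eq_UNIV[OF _ assms(6,8)] assms(6)
    unfolding simple_op_module_def by blast
qed

end
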